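(* Let $R$ be a valuation ring (with value group of arbitrary rank). Then every $R$-lattice $M$ admits a Jordan decomposition.
   Context: A valuation ring $R$ is an integral domain with fraction field $\mathbb{K}$, together with a totally ordered abelian group $\Gamma$ (written additively, no restriction on its rank) and a surjective homomorphism $v:\mathbb{K}^{*}\to\Gamma$ satisfying $v(x+y)\geq\min\{v(x),v(y)\}$, extended by $v(0)=\infty$, such that $R=\{x\in\mathbb{K}: v(x)\geq0\}$. An $R$-lattice is a free $R$-module $M$ of finite rank with a symmetric bilinear form $(\cdot,\cdot):M\times M\to R$ which is non-degenerate, i.e. the induced map $M\to \mathrm{Hom}_{R}(M,R)$ is injective. It is unimodular if this map is bijective. For a lattice $L$ and $0\neq a\in R$, $L(a)$ denotes the lattice obtained from $L$ by multiplying the bilinear form by $a$. A lattice is uni-valued if it can be written as $L(\sigma)$ with $L$ unimodular and $0\neq\sigma\in R$. A Jordan decomposition of $M$ is a presentation of $M$ as an orthogonal direct sum $\bigoplus_{k=1}^{t}M_{k}$ of uni-valued lattices $M_{k}=L_{k}(\sigma_{k})$ ($L_{k}$ unimodular) such that $v(\sigma_{k})\neq v(\sigma_{l})$ whenever $k\neq l$. *)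

theory Defs
  imports
    "HOL-Computational_Algebra.Computational_Algebra"
    "HOL-Library.FuncSet"
begin

text \<open>
  The ring is the type \<open>'a\<close> and its fraction field is \<open>'a fract\<close>; the value group is the whole type
  \<open>'g\<close>. The value of \<open>v\<close> at \<open>0\<close>, which should be infinity, is junk and is never used.
\<close>

locale valuation_ring =
  fixes v :: "'a::idom fract \<Rightarrow> 'g::linordered_ab_group_add"
  assumes v_mult: "\<And>x y. x \<noteq> 0 \<Longrightarrow> y \<noteq> 0 \<Longrightarrow> v (x * y) = v x + v y"
    and v_surj: "v ` (UNIV - {0}) = UNIV"
    and v_add: "\<And>x y. x \<noteq> 0 \<Longrightarrow> y \<noteq> 0 \<Longrightarrow> x + y \<noteq> 0 \<Longrightarrow> v (x + y) \<ge> min (v x) (v y)"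
    and ring_eq: "range to_fract = {x. x = 0 \<or> v x \<ge> 0}"

text \<open>
  Modules are carried by submodules \<open>M\<close> of an ambient module type \<open>'b\<close>, so that the summands of a
  decomposition are objects of the same kind. A form on \<open>M\<close> is a function on \<open>'b\<close>
  of which only the values on \<open>M\<close> are relevant.
\<close>

locale idom_module = module scale
  for scale :: "'a::idom \<Rightarrow> 'b::ab_group_add \<Rightarrow> 'b" (infixr \<open>*s\<close> 75)
begin

definition free_of_finite_rank :: "'b set \<Rightarrow> bool" where
  "free_of_finite_rank M \<longleftrightarrow> (\<exists>B. finite B \<and> independent B \<and> span B = M)"

text \<open>Elements of the dual are \<open>undefined\<close> outside \<open>M\<close>, to be determined by their values on \<open>M\<close>.\<close>

definition dual :: "'b set \<Rightarrow> ('b \<Rightarrow> 'a) set" where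
  "dual M = {f \<in> extensional M.
     (\<forall>x\<in>M. \<forall>y\<in>M. f (x + y) = f x + f y) \<and> (\<forall>r. \<forall>x\<in>M. f (r *s x) = r * f x)}"

definition symmetric_bilinear_on :: "'b set \<Rightarrow> ('b \<Rightarrow> 'b \<Rightarrow> 'a) \<Rightarrow> bool" where
  "symmetric_bilinear_on M b \<longleftrightarrow>
     (\<forall>x\<in>M. \<forall>y\<in>M. b x y = b y x) \<and>
     (\<forall>x\<in>M. \<forall>y\<in>M. \<forall>z\<in>M. b (x + y) z = b x z + b y z) \<and>
     (\<forall>r. \<forall>x\<in>M. \<forall>z\<in>M. b (r *s x) z = r * b x z)"

definition induced_map :: "'b set \<Rightarrow> ('b \<Rightarrow> 'b \<Rightarrow> 'a) \<Rightarrow> 'b \<Rightarrow> 'b \<Rightarrow> 'a" where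
  "induced_map M b x = restrict (b x) M"

definition is_lattice :: "'b set \<Rightarrow> ('b \<Rightarrow> 'b \<Rightarrow> 'a) \<Rightarrow> bool" where
  "is_lattice M b \<longleftrightarrow>
     free_of_finite_rank M \<and> symmetric_bilinear_on M b \<and> inj_on (induced_map M b) M"

definition unimodular :: "'b set \<Rightarrow> ('b \<Rightarrow> 'b \<Rightarrow> 'a) \<Rightarrow> bool" where
  "unimodular M b \<longleftrightarrow> is_lattice M b \<and> bij_betw (induced_map M b) M (dual M)"

text \<open>The lattice \<open>(M, b)\<close> is of the form \<open>L(\<sigma>)\<close> with \<open>L = (M, c)\<close> unimodular.\<close>

definition uni_valued_with :: "'b set \<Rightarrow> ('b \<Rightarrow> 'b \<Rightarrow> 'a) \<Rightarrow> 'a \<Rightarrow> bool" where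
  "uni_valued_with M b \<sigma> \<longleftrightarrow>
     is_lattice M b \<and> \<sigma> \<noteq> 0 \<and> (\<exists>c. unimodular M c \<and> (\<forall>x\<in>M. \<forall>y\<in>M. b x y = \<sigma> * c x y))"

text \<open>Directness: addition is a bijection from the external direct sum of the \<open>N k\<close> onto \<open>M\<close>.\<close>

definition orthogonal_direct_sum ::
  "'b set \<Rightarrow> ('b \<Rightarrow> 'b \<Rightarrow> 'a) \<Rightarrow> nat \<Rightarrow> (nat \<Rightarrow> 'b set) \<Rightarrow> bool" where
  "orthogonal_direct_sum M b t N \<longleftrightarrow>
     (\<forall>k\<in>{1..t}. subspace (N k)) \<and>
     bij_betw (\<lambda>x. \<Sum>k=1..t. x k) (\<Pi>\<^sub>E k\<in>{1..t}. N k) M \<and>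
     (\<forall>k\<in>{1..t}. \<forall>l\<in>{1..t}. k \<noteq> l \<longrightarrow> (\<forall>x\<in>N k. \<forall>y\<in>N l. b x y = 0))"

end

definition jordan_decomposition ::
  "('a::idom fract \<Rightarrow> 'g::linordered_ab_group_add) \<Rightarrow> ('a \<Rightarrow> 'b::ab_group_add \<Rightarrow> 'b) \<Rightarrow>
   'b set \<Rightarrow> ('b \<Rightarrow> 'b \<Rightarrow> 'a) \<Rightarrow> nat \<Rightarrow> (nat \<Rightarrow> 'b set) \<Rightarrow> (nat \<Rightarrow> 'a) \<Rightarrow> bool" where
  "jordan_decomposition v scale M b t N \<sigma> \<longleftrightarrow>
     idom_module.orthogonal_direct_sum scale M b t N \<and>
     (\<forall>k\<in>{1..t}. idom_module.uni_valued_with scale (N k) b (\<sigma> k)) \<and>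
     (\<forall>k\<in>{1..t}. \<forall>l\<in>{1..t}. k \<noteq> l \<longrightarrow> v (to_fract (\<sigma> k)) \<noteq> v (to_fract (\<sigma> l)))"

end

theory Submission
  imports Defs
begin

text \<open>
  The valuation enters through one consequence only: of two ring elements, one divides the other.
  Hence among the finitely many values \<open>b e f\<close> on a basis there is one, \<open>\<sigma>\<close>, that divides all of
  them, and it then divides every value of the form. Non-degeneracy gives \<open>\<sigma> \<noteq> 0\<close>.

  If \<open>b e e\<close> or \<open>b f f\<close> is an associate of \<open>\<sigma>\<close>, then the line through \<open>e\<close> or \<open>f\<close> is, up to the
  factor \<open>\<sigma>\<close>, unimodular. Otherwise the plane through \<open>e\<close> and \<open>f\<close> is: its Gram matrix divided by
  \<open>\<sigma>\<close> has a unit off the diagonal and non-units on it, and its determinant is a unit because the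
  non-units form an ideal (\<open>modular_pair\<close>). Planes cannot be avoided, since \<open>2\<close> need not be a unit.

  A sublattice on which the form is \<open>\<sigma>\<close> times a unimodular one splits off orthogonally: every value
  of the form is divisible by \<open>\<sigma>\<close>, so each vector has an orthogonal projection to the sublattice, and
  subtracting it from the other basis vectors gives a basis of the complement (\<open>basis_shear\<close>). As
  long as two remaining basis vectors have a product associated to \<open>\<sigma>\<close>, a further line or plane can
  be moved to the sublattice (\<open>splitting_step\<close>). At the end \<open>M\<close> is the orthogonal sum of
  a nonzero uni-valued lattice of scale \<open>\<sigma>\<close> and a lattice all of whose values are proper multiples of
  \<open>\<sigma>\<close> (\<open>lattice_splits\<close>). The second has smaller rank and so is decomposed by induction. The
  scales of its summands are values of its form; they therefore have a valuation different from that
  of \<open>\<sigma>\<close>, and summands of equal valuation never have to be merged.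
\<close>

section \<open>Bases of free modules\<close>

context module
begin

text \<open>
  Independence of \<open>S \<union> T\<close> as independence of \<open>S\<close> together with independence of \<open>T\<close> modulo \<open>span S\<close>.
  In this form it visibly survives changing the elements of \<open>T\<close> by elements of \<open>span S\<close>.
\<close>

lemma independent_Un_iff:
  assumes "finite S" "finite T" "S \<inter> T = {}"
  shows "independent (S \<union> T) \<longleftrightarrow>
    independent S \<and> (\<forall>c. (\<Sum>t\<in>T. c t *s t) \<in> span S \<longrightarrow> (\<forall>t\<in>T. c t = 0))"
proof (intro iffI conjI allI impI)
  assume ind: "independent (S \<union> T)"
  then show "independent S"
    by (rule independent_mono) simp
  fix c assume "(\<Sum>t\<in>T. c t *s t) \<in> span S"
  then obtain d where d: "(\<Sum>t\<in>T. c t *s t) = (\<Sum>s\<in>S. d s *s s)"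
    using span_finite[OF assms(1)] by auto
  define u where "u v = (if v \<in> T then c v else - d v)" for v
  have "(\<Sum>v\<in>S \<union> T. u v *s v) = (\<Sum>v\<in>S. u v *s v) + (\<Sum>v\<in>T. u v *s v)"
    using assms by (intro sum.union_disjoint)
  also have "(\<Sum>v\<in>S. u v *s v) = (\<Sum>v\<in>S. - (d v *s v))"
    using assms(3) by (intro sum.cong) (auto simp: u_def)
  also have "(\<Sum>v\<in>T. u v *s v) = (\<Sum>v\<in>T. c v *s v)"
    by (intro sum.cong) (auto simp: u_def)
  finally have "(\<Sum>v\<in>S \<union> T. u v *s v) = 0"
    by (simp add: d sum_negf)
  then have u0: "\<forall>v\<in>S \<union> T. u v = 0"
    using ind assms(1,2) by (metis dependent_finite finite_UnI)
  show "\<forall>t\<in>T. c t = 0"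
  proof
    fix t assume "t \<in> T"
    then show "c t = 0"
      using u0[rule_format, of t] by (simp add: u_def)
  qed
next
  assume *: "independent S \<and> (\<forall>c. (\<Sum>t\<in>T. c t *s t) \<in> span S \<longrightarrow> (\<forall>t\<in>T. c t = 0))"
  show "independent (S \<union> T)"
  proof
    assume "dependent (S \<union> T)"
    then obtain u where u: "\<exists>v\<in>S \<union> T. u v \<noteq> 0" "(\<Sum>v\<in>S \<union> T. u v *s v) = 0"
      using assms dependent_finite by (metis finite_UnI)
    have sum0: "(\<Sum>v\<in>S. u v *s v) + (\<Sum>v\<in>T. u v *s v) = 0"
      using u(2) assms by (simp add: sum.union_disjoint)
    then have "(\<Sum>v\<in>T. u v *s v) = (\<Sum>v\<in>S. (- u v) *s v)"
      by (simp add: sum_negf eq_neg_iff_add_eq_0 add.commute)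
    then have "(\<Sum>v\<in>T. u v *s v) \<in> span S"
      by (simp only:) (intro span_sum span_scale span_base)
    with * have T0: "\<forall>v\<in>T. u v = 0"
      by blast
    with sum0 have "(\<Sum>v\<in>S. u v *s v) = 0"
      by simp
    with * assms(1) have "\<forall>v\<in>S. u v = 0"
      by (metis dependent_finite)
    with T0 u(1) show False
      by blast
  qed
qed

lemma basis_shear:
  assumes fin: "finite S" "finite T" and disj: "S \<inter> T = {}" and ind: "independent (S \<union> T)"
    and p: "\<And>t. t \<in> T \<Longrightarrow> p t \<in> span S"
  shows "S \<inter> (\<lambda>t. t - p t) ` T = {}"
    and "independent (S \<union> (\<lambda>t. t - p t) ` T)"
    and "span (S \<union> (\<lambda>t. t - p t) ` T) = span (S \<union> T)"
proof -
  let ?q = "\<lambda>t. t - p t"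
  have indS: "independent S"
    and indT: "\<And>c. (\<Sum>t\<in>T. c t *s t) \<in> span S \<Longrightarrow> \<forall>t\<in>T. c t = 0"
    using ind independent_Un_iff[OF fin disj] by blast+
  have indq: "\<forall>t\<in>T. c t = 0" if "(\<Sum>t\<in>T. c t *s ?q t) \<in> span S" for c
  proof (rule indT)
    have "(\<Sum>t\<in>T. c t *s t) = (\<Sum>t\<in>T. c t *s ?q t) + (\<Sum>t\<in>T. c t *s p t)"
      by (simp add: scale_right_diff_distrib sum_subtractf)
    also have "\<dots> \<in> span S"
      by (intro span_add that span_sum span_scale p)
    finally show "(\<Sum>t\<in>T. c t *s t) \<in> span S" .
  qed
  \<comment> \<open>A vector \<open>?q g\<close> in \<open>span S\<close>, or an equality \<open>?q g = ?q h\<close>, would be a nontrivial relation modulo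
    \<open>span S\<close>, with coefficients given by indicator functions.\<close>
  have delta: "(\<Sum>t\<in>T. (if t = g then 1 else 0) *s ?q t) = ?q g" if "g \<in> T" for g
  proof -
    have "(\<Sum>t\<in>T. (if t = g then 1 else 0) *s ?q t) = (\<Sum>t\<in>T. if t = g then ?q t else 0)"
      by (intro sum.cong) auto
    then show ?thesis
      using that fin by simp
  qed
  have notin: "?q g \<notin> span S" if "g \<in> T" for g
    using bspec[OF indq[of "\<lambda>t. if t = g then 1 else 0"], of g] that by (auto simp: delta)
  then show disj': "S \<inter> ?q ` T = {}"
    using span_base by blast
  have inj: "inj_on ?q T"
  proof (rule inj_onI, rule ccontr)
    fix g h assume gh: "g \<in> T" "h \<in> T" "?q g = ?q h" "g \<noteq> h"
    have "(\<Sum>t\<in>T. ((if t = g then 1 else 0) - (if t = h then 1 else 0)) *s ?q t) = ?q g - ?q h"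
      by (simp only: scale_left_diff_distrib sum_subtractf delta gh)
    also have "\<dots> \<in> span S"
      using gh(3) by (simp add: span_zero)
    finally show False
      using bspec[OF indq[of "\<lambda>t. (if t = g then 1 else 0) - (if t = h then 1 else 0)"], of g] gh
      by simp
  qed
  have "\<forall>t\<in>?q ` T. c t = 0" if "(\<Sum>t\<in>?q ` T. c t *s t) \<in> span S" for c
    using indq[of "\<lambda>t. c (?q t)"] that by (simp add: sum.reindex[OF inj])
  then show "independent (S \<union> ?q ` T)"
    using indS independent_Un_iff[OF fin(1) finite_imageI[OF fin(2)] disj'] by blast
  have pS: "p t \<in> span (S \<union> X)" if "t \<in> T" for t X
    using p[OF that] span_mono[of S "S \<union> X"] by blast
  have "?q t \<in> span (S \<union> T)" if "t \<in> T" for t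
    using that pS[OF that] by (intro span_diff) (auto intro: span_base)
  moreover have "t \<in> span (S \<union> ?q ` T)" if "t \<in> T" for t
  proof -
    have "?q t + p t \<in> span (S \<union> ?q ` T)"
      using that pS[OF that] by (intro span_add) (auto intro: span_base)
    then show ?thesis
      by simp
  qed
  ultimately show "span (S \<union> ?q ` T) = span (S \<union> T)"
    unfolding span_eq by (auto intro: span_base)
qed

end


section \<open>Rings in which divisibility is total\<close>

lemma (in valuation_ring) v_le_imp_dvd:
  assumes "x \<noteq> 0" "y \<noteq> 0" "v (to_fract x) \<le> v (to_fract y)"
  shows "x dvd y"
proof -
  define q where "q = to_fract y / to_fract x"
  have q: "q \<noteq> 0" "to_fract y = to_fract x * q"
    using assms by (auto simp: q_def)
  then have "v (to_fract y) = v (to_fract x) + v q"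
    using assms by (simp add: v_mult)
  then have "v q \<ge> 0"
    using assms(3) by simp
  then have "q \<in> range to_fract"
    using ring_eq by blast
  then obtain r where "q = to_fract r"
    by blast
  then have "to_fract y = to_fract (x * r)"
    using q by simp
  then show ?thesis
    by (simp only: to_fract_eq_iff dvd_def) blast
qed

lemma (in valuation_ring) dvd_total:
  fixes x y :: 'a
  shows "x dvd y \<or> y dvd x"
proof (cases "x = 0 \<or> y = 0")
  case False
  then show ?thesis
    using v_le_imp_dvd linear[of "v (to_fract x)" "v (to_fract y)"] by blast
qed auto

text \<open>
  A domain in which divisibility is total is the same thing as a valuation ring, with its value group
  forgotten.
\<close>

locale chain_module = idom_module scale
  for scale :: "'a::idom \<Rightarrow> 'b::ab_group_add \<Rightarrow> 'b" (infixr \<open>*s\<close> 75) +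
  assumes dvd_total: "\<And>x y :: 'a. x dvd y \<or> y dvd x"
begin

text \<open>
  Contrapositively, the non-divisors of \<open>d\<close> are closed under addition. For \<open>d = 1\<close> this says that the
  ring is local; for \<open>d = \<sigma>\<close> it is how ``all values are proper multiples of \<open>\<sigma>\<close>'' passes from a basis
  to its span.
\<close>

lemma add_dvd_cases:
  fixes x y d :: 'a
  assumes "x + y dvd d"
  shows "x dvd d \<or> y dvd d"
  using dvd_total[of x y]
proof
  assume "x dvd y"
  then have "x dvd x + y"
    by simp
  then show ?thesis
    using assms dvd_trans by blast
next
  assume "y dvd x"
  then have "y dvd x + y"
    by simp
  then show ?thesis
    using assms dvd_trans by blast
qed

lemma finite_has_dvd_least:
  fixes A :: "'a set"
  assumes "finite A" "A \<noteq> {}"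
  shows "\<exists>x\<in>A. \<forall>y\<in>A. x dvd y"
  using assms
proof (induction rule: finite_ne_induct)
  case (insert z F)
  then obtain x where x: "x \<in> F" "\<forall>y\<in>F. x dvd y"
    by blast
  show ?case
  proof (cases "x dvd z")
    case True
    then show ?thesis
      using x by blast
  next
    case False
    then have "z dvd x"
      using dvd_total by blast
    then have "\<forall>y\<in>insert z F. z dvd y"
      using x(2) by (auto intro: dvd_trans[of z x])
    then show ?thesis
      by blast
  qed
qed auto

end


section \<open>Splitting off a modular summand\<close>

locale symmetric_form = chain_module scale
  for scale :: "'a::idom \<Rightarrow> 'b::ab_group_add \<Rightarrow> 'b" (infixr \<open>*s\<close> 75) +
  fixes M :: "'b set" and b :: "'b \<Rightarrow> 'b \<Rightarrow> 'a"
  assumes subspace_M: "subspace M" and symmetric_bilinear: "symmetric_bilinear_on M b"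
begin

lemma form_commute: "x \<in> M \<Longrightarrow> y \<in> M \<Longrightarrow> b x y = b y x"
  and form_add_left: "x \<in> M \<Longrightarrow> y \<in> M \<Longrightarrow> z \<in> M \<Longrightarrow> b (x + y) z = b x z + b y z"
  and form_scale_left: "x \<in> M \<Longrightarrow> z \<in> M \<Longrightarrow> b (r *s x) z = r * b x z"
  using symmetric_bilinear unfolding symmetric_bilinear_on_def by blast+

lemma form_add_right: "x \<in> M \<Longrightarrow> y \<in> M \<Longrightarrow> z \<in> M \<Longrightarrow> b z (x + y) = b z x + b z y"
  using form_commute form_add_left subspace_M subspace_add by metis

lemma form_scale_right: "x \<in> M \<Longrightarrow> z \<in> M \<Longrightarrow> b z (r *s x) = r * b z x"
  using form_commute form_scale_left subspace_M subspace_scale by metis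

lemma form_diff_left: "x \<in> M \<Longrightarrow> y \<in> M \<Longrightarrow> z \<in> M \<Longrightarrow> b (x - y) z = b x z - b y z"
  using form_add_left[of "x - y" y z] subspace_M by (simp add: subspace_diff)

lemma form_zero_left: "z \<in> M \<Longrightarrow> b 0 z = 0"
  using form_scale_left[of 0 z 0] subspace_M by (simp add: subspace_0)

lemma form_zero_right: "z \<in> M \<Longrightarrow> b z 0 = 0"
  using form_scale_right[of 0 z 0] subspace_M by (simp add: subspace_0)

lemma span_subset_M: "X \<subseteq> M \<Longrightarrow> span X \<subseteq> M"
  using span_minimal subspace_M by blast

text \<open>
  Orthogonality, divisibility by \<open>\<sigma>\<close> and failure to divide \<open>\<sigma>\<close> are all membership of the values in an
  ideal \<open>P\<close>, so it suffices to check them on generators.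
\<close>

lemma form_on_spans:
  assumes X: "X \<subseteq> M" and Y: "Y \<subseteq> M"
    and P0: "P 0" and Padd: "\<And>r s. P r \<Longrightarrow> P s \<Longrightarrow> P (r + s)"
    and Pmult: "\<And>r s. P s \<Longrightarrow> P (r * s)"
    and base: "\<And>x y. x \<in> X \<Longrightarrow> y \<in> Y \<Longrightarrow> P (b x y)"
    and x: "x \<in> span X" and y: "y \<in> span Y"
  shows "P (b x y)"
proof -
  note XM = subsetD[OF X] subsetD[OF span_subset_M[OF X]]
  note YM = subsetD[OF Y] subsetD[OF span_subset_M[OF Y]]
  note closed = subspace_add[OF subspace_M] subspace_scale[OF subspace_M] subspace_0[OF subspace_M]
  have Py: "y \<in> M \<and> P (b z y)" if z: "z \<in> X" for z
    using y
  proof (induction rule: span_induct_alt)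
    case base
    then show ?case
      using XM z by (simp add: form_zero_right P0 closed)
  next
    case (step c u w)
    then show ?case
      using XM YM z base by (simp add: form_add_right form_scale_right Padd Pmult closed)
  qed
  from x have "x \<in> M \<and> P (b x y)"
  proof (induction rule: span_induct_alt)
    case base
    then show ?case
      using YM y by (simp add: form_zero_left P0 closed)
  next
    case (step c u w)
    then show ?case
      using XM YM y Py by (simp add: form_add_left form_scale_left Padd Pmult closed)
  qed
  then show ?thesis ..
qed

text \<open>
  For independent \<open>S\<close>, the functions \<open>f\<close> on \<open>S\<close> are the linear functionals on \<open>span S\<close>; so this is
  surjectivity onto the dual for the form \<open>b / \<sigma>\<close>, stated without division. It does not include
  divisibility of the values on \<open>S\<close> by \<open>\<sigma>\<close>.
\<close>

definition modular :: "'a \<Rightarrow> 'b set \<Rightarrow> bool" where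
  "modular \<sigma> S \<longleftrightarrow> (\<forall>f. \<exists>n\<in>span S. \<forall>s\<in>S. b n s = \<sigma> * f s)"

text \<open>Taking \<open>g = b x\<close> yields the orthogonal projection of \<open>x\<close> to \<open>span S\<close>.\<close>

lemma modularE:
  assumes "modular \<sigma> S" "\<And>s. s \<in> S \<Longrightarrow> \<sigma> dvd g s"
  obtains n where "n \<in> span S" "\<And>s. s \<in> S \<Longrightarrow> b n s = g s"
proof -
  obtain f where "\<And>s. s \<in> S \<Longrightarrow> g s = \<sigma> * f s"
    using assms(2) unfolding dvd_def by metis
  then show ?thesis
    using assms(1) that unfolding modular_def by metis
qed

lemma orthogonal_spans:
  assumes "S \<subseteq> M" "T \<subseteq> M" "\<And>s t. s \<in> S \<Longrightarrow> t \<in> T \<Longrightarrow> b s t = 0" "x \<in> span S" "y \<in> span T"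
  shows "b x y = 0"
  by (rule form_on_spans[of S T "\<lambda>r. r = 0"]) (use assms in auto)

lemma modular_Un:
  assumes M: "S \<subseteq> M" "T \<subseteq> M" and mod: "modular \<sigma> S" "modular \<sigma> T"
    and orth: "\<And>s t. s \<in> S \<Longrightarrow> t \<in> T \<Longrightarrow> b s t = 0"
  shows "modular \<sigma> (S \<union> T)"
  unfolding modular_def
proof
  fix f
  obtain m where m: "m \<in> span S" "\<forall>s\<in>S. b m s = \<sigma> * f s"
    using mod unfolding modular_def by blast
  obtain n where n: "n \<in> span T" "\<forall>s\<in>T. b n s = \<sigma> * f s"
    using mod unfolding modular_def by blast
  have mn: "m \<in> M" "n \<in> M"
    using m n M span_subset_M by blast+
  have "b n s = 0" if "s \<in> S" for s
    using orthogonal_spans[OF M orth, of s n] that n mn M form_commute[of s n]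
    by (auto simp: span_base)
  moreover have "b m s = 0" if "s \<in> T" for s
    using orthogonal_spans[OF M orth, of m s] that m by (auto simp: span_base)
  ultimately have "\<forall>s\<in>S \<union> T. b (m + n) s = \<sigma> * f s"
    using m n mn M by (auto simp: form_add_left subset_iff)
  moreover have "m + n \<in> span (S \<union> T)"
    using m n by (auto simp: span_Un)
  ultimately show "\<exists>n\<in>span (S \<union> T). \<forall>s\<in>S \<union> T. b n s = \<sigma> * f s"
    by blast
qed

lemma modular_singleton:
  assumes "e \<in> M" "b e e dvd \<sigma>"
  shows "modular \<sigma> {e}"
  unfolding modular_def
proof
  fix f
  obtain w where w: "\<sigma> = b e e * w"
    using assms by auto
  have "(w * f e) *s e \<in> span {e}"
    by (intro span_scale span_base) simp
  moreover have "\<forall>s\<in>{e}. b ((w * f e) *s e) s = \<sigma> * f s"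
    using assms w by (simp add: form_scale_left mult_ac)
  ultimately show "\<exists>n\<in>span {e}. \<forall>s\<in>{e}. b n s = \<sigma> * f s"
    by blast
qed

text \<open>
  With Gram matrix \<open>\<sigma>\<close> times \<open>(\<alpha>, u; u, \<beta>)\<close>, the element \<open>u\<close> is a unit and \<open>\<alpha>\<close> is not, so the
  determinant \<open>\<alpha> * \<beta> - u * u\<close> is a unit in the local ring and Cramer's rule solves the system.
\<close>

lemma modular_pair:
  assumes M: "e \<in> M" "f \<in> M" and "\<sigma> \<noteq> 0"
    and dvd: "\<sigma> dvd b e e" "\<sigma> dvd b e f" "\<sigma> dvd b f f"
    and unit: "b e f dvd \<sigma>" and nonunit: "\<not> b e e dvd \<sigma>"
  shows "modular \<sigma> {e, f}"
  unfolding modular_def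
proof
  fix g
  obtain \<alpha> u \<beta> where eq: "b e e = \<sigma> * \<alpha>" "b e f = \<sigma> * u" "b f f = \<sigma> * \<beta>"
    using dvd unfolding dvd_def by blast
  have "u dvd 1" "\<not> \<alpha> dvd 1"
    using unit nonunit \<open>\<sigma> \<noteq> 0\<close> unfolding eq by simp_all
  have "\<alpha> * \<beta> - u * u dvd 1"
  proof -
    have "\<alpha> * \<beta> + - (\<alpha> * \<beta> - u * u) dvd 1"
      using \<open>u dvd 1\<close> mult_dvd_mono[of u 1 u 1] by simp
    from add_dvd_cases[OF this] show ?thesis
      using \<open>\<not> \<alpha> dvd 1\<close> dvd_mult_left minus_dvd_iff by metis
  qed
  then obtain w where w: "1 = (\<alpha> * \<beta> - u * u) * w"
    by (rule dvdE)
  define x where "x = w * (g e * \<beta> - g f * u)"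
  define y where "y = w * (g f * \<alpha> - g e * u)"
  have "x * \<alpha> + y * u = ((\<alpha> * \<beta> - u * u) * w) * g e"
    by (simp add: x_def y_def algebra_simps)
  then have 1: "x * \<alpha> + y * u = g e"
    using w by simp
  have "x * u + y * \<beta> = ((\<alpha> * \<beta> - u * u) * w) * g f"
    by (simp add: x_def y_def algebra_simps)
  then have 2: "x * u + y * \<beta> = g f"
    using w by simp
  have xy: "x *s e + y *s f \<in> span {e, f}"
    by (intro span_add span_scale span_base) auto
  have M': "x *s e \<in> M" "y *s f \<in> M"
    using M subspace_M subspace_scale by blast+
  have "b f e = \<sigma> * u"
    using eq M form_commute by simp
  then have "b (x *s e + y *s f) e = \<sigma> * (x * \<alpha> + y * u)"
    "b (x *s e + y *s f) f = \<sigma> * (x * u + y * \<beta>)"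
    using M M' eq by (simp_all add: form_add_left form_scale_left algebra_simps)
  then have "\<forall>s\<in>{e, f}. b (x *s e + y *s f) s = \<sigma> * g s"
    by (simp add: 1 2)
  with xy show "\<exists>n\<in>span {e, f}. \<forall>s\<in>{e, f}. b n s = \<sigma> * g s"
    by blast
qed

text \<open>
  An orthogonal decomposition of \<open>M\<close> is recorded by an adapted basis, so that both summands are free by
  construction. Here \<open>S\<close> spans the part already split off.
\<close>

definition splitting :: "'a \<Rightarrow> 'b set \<Rightarrow> 'b set \<Rightarrow> bool" where
  "splitting \<sigma> S T \<longleftrightarrow> finite S \<and> finite T \<and> S \<inter> T = {} \<and> independent (S \<union> T) \<and>
     span (S \<union> T) = M \<and> modular \<sigma> S \<and> (\<forall>s\<in>S. \<forall>t\<in>T. b s t = 0)"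

lemma splitting_step:
  assumes "\<sigma> \<noteq> 0" and dvd: "\<And>x y. x \<in> M \<Longrightarrow> y \<in> M \<Longrightarrow> \<sigma> dvd b x y"
    and split: "splitting \<sigma> S T"
    and ef: "e \<in> T" "f \<in> T" "b e f dvd \<sigma>"
  shows "\<exists>S' T'. splitting \<sigma> S' T' \<and> card T' < card T"
proof -
  have fin: "finite S" "finite T" and disj: "S \<inter> T = {}" and ind: "independent (S \<union> T)"
    and span: "span (S \<union> T) = M" and mod: "modular \<sigma> S"
    and orth: "\<And>s t. s \<in> S \<Longrightarrow> t \<in> T \<Longrightarrow> b s t = 0"
    using split unfolding splitting_def by blast+
  have M: "S \<subseteq> M" "T \<subseteq> M"
    using span span_superset by blast+
  obtain U where U: "U \<subseteq> T" "U \<noteq> {}" "modular \<sigma> U"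
  proof (cases "b e e dvd \<sigma>")
    case True
    then show ?thesis
      using that[of "{e}"] modular_singleton[of e \<sigma>] ef M by auto
  next
    case False
    have "modular \<sigma> {e, f}"
      using ef M \<open>\<sigma> \<noteq> 0\<close> False by (intro modular_pair dvd) auto
    then show ?thesis
      using that[of "{e, f}"] ef by auto
  qed
  \<comment> \<open>Projecting to the whole of \<open>span S'\<close> rather than to \<open>span U\<close> makes the sheared vectors orthogonal
    to old and new elements alike.\<close>
  define S' where "S' = S \<union> U"
  have S'T: "S' \<union> (T - U) = S \<union> T"
    using U by (auto simp: S'_def)
  have S': "finite S'" "S' \<inter> (T - U) = {}" "S' \<subseteq> M"
    using fin U disj M finite_subset[OF U(1)] by (auto simp: S'_def)
  have mod': "modular \<sigma> S'"
    unfolding S'_def using M U mod orth by (intro modular_Un) auto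
  have "\<exists>n. n \<in> span S' \<and> (\<forall>s\<in>S'. b n s = b t s)" if "t \<in> T" for t
    by (rule modularE[OF mod', of "b t"]) (use that S' M dvd in blast)+
  then obtain p where p: "\<And>t. t \<in> T \<Longrightarrow> p t \<in> span S'"
    "\<And>t s. t \<in> T \<Longrightarrow> s \<in> S' \<Longrightarrow> b (p t) s = b t s"
    by metis
  define T' where "T' = (\<lambda>t. t - p t) ` (T - U)"
  have shear: "S' \<inter> T' = {}" "independent (S' \<union> T')" "span (S' \<union> T') = M"
    unfolding T'_def
    using basis_shear[of S' "T - U" p] S' p(1) fin ind span by (auto simp: S'T)
  have "b s t = 0" if "s \<in> S'" "t \<in> T'" for s t
  proof -
    obtain g where g: "g \<in> T" "t = g - p g"
      using \<open>t \<in> T'\<close> by (auto simp: T'_def)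
    have gM: "s \<in> M" "g \<in> M" "p g \<in> M"
      using that g S' M p(1)[OF g(1)] span_subset_M by blast+
    then have "b t s = 0"
      using g p(2)[OF g(1) \<open>s \<in> S'\<close>] by (simp add: form_diff_left)
    then show ?thesis
      using gM g subspace_M by (simp add: form_commute subspace_diff)
  qed
  then have "splitting \<sigma> S' T'"
    using S' shear mod' fin by (auto simp: splitting_def T'_def)
  moreover have "card T' \<le> card (T - U)"
    unfolding T'_def using fin by (intro card_image_le) simp
  moreover have "card (T - U) < card T"
    using U fin by (intro psubset_card_mono) auto
  ultimately show ?thesis
    by (meson le_less_trans)
qed

lemma maximal_splitting:
  assumes "\<sigma> \<noteq> 0" and dvd: "\<And>x y. x \<in> M \<Longrightarrow> y \<in> M \<Longrightarrow> \<sigma> dvd b x y"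
    and "splitting \<sigma> S T"
  shows "\<exists>S' T'. splitting \<sigma> S' T' \<and> card T' \<le> card T \<and> (\<forall>e\<in>T'. \<forall>f\<in>T'. \<not> b e f dvd \<sigma>)"
  using assms(3)
proof (induction "card T" arbitrary: S T rule: less_induct)
  case less
  show ?case
  proof (cases "\<forall>e\<in>T. \<forall>f\<in>T. \<not> b e f dvd \<sigma>")
    case True
    then show ?thesis
      using less.prems by blast
  next
    case False
    then obtain S1 T1 where "splitting \<sigma> S1 T1" "card T1 < card T"
      using splitting_step[OF assms(1) dvd less.prems] by blast
    then show ?thesis
      using less.hyps by (meson le_trans less_imp_le)
  qed
qed

text \<open>
  Non-degeneracy passes to an orthogonal summand: two vectors of it with the same products inside the
  summand also have the same (zero) products with the complement, hence with all of \<open>M\<close>.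
\<close>

lemma orthogonal_summand_is_lattice:
  assumes M: "is_lattice M b" and XY: "X \<subseteq> M" "Y \<subseteq> M" and fin: "finite X"
    and ind: "independent X" and span: "span (X \<union> Y) = M"
    and orth: "\<And>x y. x \<in> X \<Longrightarrow> y \<in> Y \<Longrightarrow> b x y = 0"
  shows "is_lattice (span X) b"
  unfolding is_lattice_def
proof (intro conjI)
  note sub = subsetD[OF span_subset_M[OF XY(1)]] subsetD[OF span_subset_M[OF XY(2)]]
  show "free_of_finite_rank (span X)"
    unfolding free_of_finite_rank_def using fin ind by blast
  show "symmetric_bilinear_on (span X) b"
    using symmetric_bilinear sub unfolding symmetric_bilinear_on_def by blast
  show "inj_on (induced_map (span X) b) (span X)"
  proof (rule inj_onI)
    fix x x' assume x: "x \<in> span X" "x' \<in> span X"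
      and eq: "induced_map (span X) b x = induced_map (span X) b x'"
    have "b x z = b x' z" if "z \<in> M" for z
    proof -
      obtain u w where z: "z = u + w" "u \<in> span X" "w \<in> span Y"
        using \<open>z \<in> M\<close> span span_Un[of X Y] by blast
      have "b x u = b x' u"
        using fun_cong[OF eq, of u] z by (simp add: induced_map_def)
      moreover have "b x w = 0" "b x' w = 0"
        using orthogonal_spans[OF XY orth] x z by auto
      ultimately show ?thesis
        using z sub x by (simp add: form_add_right)
    qed
    then have "induced_map M b x = induced_map M b x'"
      by (auto simp: induced_map_def)
    then show "x = x'"
      using M sub x unfolding is_lattice_def by (meson inj_onD)
  qed
qed

lemma modular_lattice_is_uni_valued:
  assumes lat: "is_lattice (span S) b" and S: "S \<subseteq> M" and "\<sigma> \<noteq> 0"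
    and dvd: "\<And>x y. x \<in> span S \<Longrightarrow> y \<in> span S \<Longrightarrow> \<sigma> dvd b x y"
    and mod: "modular \<sigma> S"
  shows "uni_valued_with (span S) b \<sigma>"
proof -
  note sub = subsetD[OF span_subset_M[OF S]]
  \<comment> \<open>The quotient form \<open>b / \<sigma>\<close>; its properties follow from those of \<open>b\<close> by cancelling \<open>\<sigma>\<close>.\<close>
  obtain c where c: "\<And>x y. x \<in> span S \<Longrightarrow> y \<in> span S \<Longrightarrow> b x y = \<sigma> * c x y"
    using dvd unfolding dvd_def by metis
  have c_eqI: "c x y = r" if "b x y = \<sigma> * r" "x \<in> span S" "y \<in> span S" for x y r
    using that c \<open>\<sigma> \<noteq> 0\<close> by simp
  have sym: "c x y = c y x" if "x \<in> span S" "y \<in> span S" for x y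
    using that c_eqI c form_commute sub by metis
  have add: "c (x + y) z = c x z + c y z"
    if "x \<in> span S" "y \<in> span S" "z \<in> span S" for x y z
    using that sub by (intro c_eqI) (simp_all add: form_add_left c[symmetric] span_add distrib_left)
  have scal: "c (r *s x) z = r * c x z" if "x \<in> span S" "z \<in> span S" for r x z
    using that sub by (intro c_eqI) (simp_all add: form_scale_left c[symmetric] span_scale mult.left_commute[of \<sigma>])
  have bil: "symmetric_bilinear_on (span S) c"
    unfolding symmetric_bilinear_on_def using sym add scal by blast
  have inj: "inj_on (induced_map (span S) c) (span S)"
  proof (rule inj_onI)
    fix x y assume xy: "x \<in> span S" "y \<in> span S"
      and eq: "induced_map (span S) c x = induced_map (span S) c y"
    have "c x z = c y z" if "z \<in> span S" for z
      using fun_cong[OF eq, of z] that by (simp add: induced_map_def)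
    then have "induced_map (span S) b x = induced_map (span S) b y"
      using xy by (auto simp: induced_map_def c)
    then show "x = y"
      using lat xy unfolding is_lattice_def by (meson inj_onD)
  qed
  have "induced_map (span S) c ` span S = dual (span S)"
  proof (intro equalityI subsetI)
    fix h assume "h \<in> induced_map (span S) c ` span S"
    then obtain n where n: "n \<in> span S" "h = induced_map (span S) c n"
      by blast
    have "c n (x + y) = c n x + c n y" if "x \<in> span S" "y \<in> span S" for x y
      using that n sym add span_add by metis
    moreover have "c n (r *s x) = r * c n x" if "x \<in> span S" for r x
      using that n sym scal span_scale by metis
    ultimately show "h \<in> dual (span S)"
      using n by (simp add: dual_def induced_map_def span_add span_scale)
  next
    fix h assume h: "h \<in> dual (span S)"
    obtain n where n: "n \<in> span S" "\<forall>s\<in>S. b n s = \<sigma> * h s"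
      using mod unfolding modular_def by blast
    have "x \<in> span S \<and> b n x = \<sigma> * h x" if "x \<in> span S" for x
      using that
    proof (induction rule: span_induct_alt)
      case base
      have "h (0 *s 0) = 0 * h 0"
        using h span_zero unfolding dual_def by blast
      then show ?case
        using n sub by (simp add: form_zero_right span_zero)
    next
      case (step r s y)
      then have "s \<in> span S" "r *s s \<in> span S"
        by (auto intro: span_base span_scale)
      moreover from this have "h (r *s s + y) = r * h s + h y"
        using h step unfolding dual_def by auto
      ultimately show ?case
        using n sub step
        by (simp add: form_add_right form_scale_right span_add algebra_simps)
    qed
    then have "c n x = h x" if "x \<in> span S" for x
      using that n c_eqI by blast
    then have "induced_map (span S) c n = h"
      using h by (auto simp: induced_map_def dual_def extensional_def)
    then show "h \<in> induced_map (span S) c ` span S"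
      using n by blast
  qed
  then have "unimodular (span S) c"
    using lat inj bil unfolding unimodular_def is_lattice_def bij_betw_def by blast
  then show ?thesis
    unfolding uni_valued_with_def using lat \<open>\<sigma> \<noteq> 0\<close> c by blast
qed

end


section \<open>Assembling the decomposition\<close>

context idom_module
begin

text \<open>
  Every \<open>x\<close> in \<open>N k\<close> is the sum of the family that is \<open>x\<close> in the place \<open>k\<close> and zero elsewhere.
\<close>

lemma orthogonal_direct_sum_component_subset:
  assumes "orthogonal_direct_sum M b t N" "k \<in> {1..t}"
  shows "N k \<subseteq> M"
proof
  fix x assume "x \<in> N k"
  let ?g = "\<lambda>j\<in>{1..t}. if j = k then x else 0"
  have "?g \<in> (\<Pi>\<^sub>E k\<in>{1..t}. N k)"
    using assms \<open>x \<in> N k\<close> subspace_0 by (auto simp: orthogonal_direct_sum_def)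
  then have "(\<Sum>j=1..t. ?g j) \<in> M"
    using assms(1) bij_betwE unfolding orthogonal_direct_sum_def by blast
  then show "x \<in> M"
    using assms(2) by simp
qed

lemma orthogonal_direct_sum_snoc:
  assumes ods: "orthogonal_direct_sum M' b t N" and L: "subspace L" and M': "subspace M'"
    and sum: "M = {x + y | x y. x \<in> L \<and> y \<in> M'}" and int: "L \<inter> M' \<subseteq> {0}"
    and orth: "\<And>x y. x \<in> L \<Longrightarrow> y \<in> M' \<Longrightarrow> b x y = 0 \<and> b y x = 0"
  shows "orthogonal_direct_sum M b (Suc t) (N(Suc t := L))"
proof -
  let ?N = "N(Suc t := L)"
  have sub: "\<And>k. k \<in> {1..t} \<Longrightarrow> subspace (N k)"
    and bij: "bij_betw (\<lambda>x. \<Sum>k=1..t. x k) (\<Pi>\<^sub>E k\<in>{1..t}. N k) M'"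
    and orthN: "\<And>k l x y. k \<in> {1..t} \<Longrightarrow> l \<in> {1..t} \<Longrightarrow> k \<noteq> l \<Longrightarrow> x \<in> N k \<Longrightarrow> y \<in> N l \<Longrightarrow> b x y = 0"
    using ods unfolding orthogonal_direct_sum_def by blast+
  have restr: "restrict x {1..t} \<in> (\<Pi>\<^sub>E k\<in>{1..t}. N k)" "(\<Sum>k=1..t. x k) \<in> M'" "x (Suc t) \<in> L"
    if "x \<in> (\<Pi>\<^sub>E k\<in>{1..Suc t}. ?N k)" for x
  proof -
    have *: "x k \<in> ?N k" if "k \<in> {1..Suc t}" for k
      using \<open>x \<in> _\<close> that by (rule PiE_mem)
    show "restrict x {1..t} \<in> (\<Pi>\<^sub>E k\<in>{1..t}. N k)"
    proof (intro restrict_PiE_iff[THEN iffD2] ballI)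
      fix k assume "k \<in> {1..t}"
      then show "x k \<in> N k"
        using *[of k] by simp
    qed
    from bij_betwE[OF bij, rule_format, OF this] show "(\<Sum>k=1..t. x k) \<in> M'"
      by simp
    show "x (Suc t) \<in> L"
      using *[of "Suc t"] by simp
  qed
  have "inj_on (\<lambda>x. \<Sum>k=1..Suc t. x k) (\<Pi>\<^sub>E k\<in>{1..Suc t}. ?N k)"
  proof (rule inj_onI)
    fix x y
    assume x: "x \<in> (\<Pi>\<^sub>E k\<in>{1..Suc t}. ?N k)" and y: "y \<in> (\<Pi>\<^sub>E k\<in>{1..Suc t}. ?N k)"
      and "(\<Sum>k=1..Suc t. x k) = (\<Sum>k=1..Suc t. y k)"
    then have eq: "x (Suc t) - y (Suc t) = (\<Sum>k=1..t. y k) - (\<Sum>k=1..t. x k)"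
      by (simp add: algebra_simps)
    have "x (Suc t) - y (Suc t) \<in> L" "(\<Sum>k=1..t. y k) - (\<Sum>k=1..t. x k) \<in> M'"
      using restr[OF x] restr[OF y] L M' by (blast intro: subspace_diff)+
    with eq int have last: "x (Suc t) = y (Suc t)" and "(\<Sum>k=1..t. x k) = (\<Sum>k=1..t. y k)"
      by auto
    then have "(\<Sum>k=1..t. restrict x {1..t} k) = (\<Sum>k=1..t. restrict y {1..t} k)"
      by simp
    then have init: "restrict x {1..t} = restrict y {1..t}"
      using bij restr(1)[OF x] restr(1)[OF y] unfolding bij_betw_def by (blast dest: inj_onD)
    show "x = y"
    proof (rule PiE_ext[OF x y])
      fix k assume "k \<in> {1..Suc t}"
      then show "x k = y k"
        using last fun_cong[OF init, of k] by (cases "k = Suc t") auto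
    qed
  qed
  moreover have "(\<lambda>x. \<Sum>k=1..Suc t. x k) ` (\<Pi>\<^sub>E k\<in>{1..Suc t}. ?N k) = M"
  proof (intro equalityI subsetI)
    fix z assume "z \<in> (\<lambda>x. \<Sum>k=1..Suc t. x k) ` (\<Pi>\<^sub>E k\<in>{1..Suc t}. ?N k)"
    then obtain x where x: "x \<in> (\<Pi>\<^sub>E k\<in>{1..Suc t}. ?N k)" "z = (\<Sum>k=1..Suc t. x k)"
      by blast
    then have "z = x (Suc t) + (\<Sum>k=1..t. x k)"
      by (simp add: add.commute)
    then show "z \<in> M"
      using restr[OF x(1)] sum by blast
  next
    fix z assume "z \<in> M"
    then obtain u w where z: "z = u + w" "u \<in> L" "w \<in> M'"
      using sum by blast
    obtain x where x: "x \<in> (\<Pi>\<^sub>E k\<in>{1..t}. N k)" "w = (\<Sum>k=1..t. x k)"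
      using z bij unfolding bij_betw_def by blast
    let ?x = "x(Suc t := u)"
    have "?x \<in> (\<Pi>\<^sub>E k\<in>{1..Suc t}. ?N k)"
    proof (rule PiE_I)
      fix k assume "k \<in> {1..Suc t}"
      then show "?x k \<in> ?N k"
        using z(2) PiE_mem[OF x(1), of k] by (cases "k = Suc t") simp_all
    next
      fix k assume "k \<notin> {1..Suc t}"
      then show "?x k = undefined"
        using PiE_arb[OF x(1), of k] by auto
    qed
    moreover have "(\<Sum>k=1..Suc t. ?x k) = z"
      using z x by (simp add: add.commute)
    ultimately show "z \<in> (\<lambda>x. \<Sum>k=1..Suc t. x k) ` (\<Pi>\<^sub>E k\<in>{1..Suc t}. ?N k)"
      by blast
  qed
  moreover have "subspace (?N k)" if "k \<in> {1..Suc t}" for k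
    using that L sub by auto
  moreover have "b x y = 0"
    if kl: "k \<in> {1..Suc t}" "l \<in> {1..Suc t}" "k \<noteq> l" and xy: "x \<in> ?N k" "y \<in> ?N l" for k l x y
  proof -
    consider "k = Suc t" "l \<in> {1..t}" | "l = Suc t" "k \<in> {1..t}" | "k \<in> {1..t}" "l \<in> {1..t}"
      using kl by force
    then show ?thesis
    proof cases
      case 1
      then show ?thesis
        using xy orth orthogonal_direct_sum_component_subset[OF ods, of l] by auto
    next
      case 2
      then show ?thesis
        using xy orth orthogonal_direct_sum_component_subset[OF ods, of k] by auto
    next
      case 3
      then show ?thesis
        using xy kl orthN[of k l x y] by auto
    qed
  qed
  ultimately show ?thesis
    unfolding orthogonal_direct_sum_def bij_betw_def by blast
qed

end

context chain_module
begin

text \<open>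
  The inductive step. The basis of the remaining lattice \<open>span T\<close> is strictly smaller because the pair
  \<open>e\<close>, \<open>f\<close> at which the least value \<open>\<sigma>\<close> is attained already permits one splitting step.
\<close>

lemma lattice_splits:
  assumes lat: "is_lattice M b" and B: "finite B" "independent B" "span B = M" "B \<noteq> {}"
  obtains \<sigma> S T where "finite S" "finite T" "independent S" "independent T" "card T < card B"
    "span (S \<union> T) = M" "is_lattice (span T) b" "uni_valued_with (span S) b \<sigma>"
    "\<And>x y. x \<in> span S \<Longrightarrow> y \<in> span T \<Longrightarrow> b x y = 0 \<and> b y x = 0"
    "span S \<inter> span T \<subseteq> {0}"
    "\<exists>x\<in>M. \<exists>y\<in>M. \<sigma> = b x y" "\<And>x y. x \<in> span T \<Longrightarrow> y \<in> span T \<Longrightarrow> \<not> b x y dvd \<sigma>"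
proof -
  interpret symmetric_form scale M b
    using lat subspace_span[of B] B by unfold_locales (auto simp: is_lattice_def)
  have BM: "B \<subseteq> M"
    using B span_superset by blast
  obtain e f where ef: "e \<in> B" "f \<in> B" and least: "\<And>x y. x \<in> B \<Longrightarrow> y \<in> B \<Longrightarrow> b e f dvd b x y"
  proof -
    have "finite ((\<lambda>(x, y). b x y) ` (B \<times> B))" "(\<lambda>(x, y). b x y) ` (B \<times> B) \<noteq> {}"
      using B by auto
    from finite_has_dvd_least[OF this] show ?thesis
      using that by fastforce
  qed
  define \<sigma> where "\<sigma> = b e f"
  have dvd: "\<sigma> dvd b x y" if "x \<in> M" "y \<in> M" for x y
    using form_on_spans[of B B "\<lambda>r. \<sigma> dvd r" x y] that BM least B by (auto simp: \<sigma>_def)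
  have "\<sigma> \<noteq> 0"
  proof
    assume "\<sigma> = 0"
    then have "induced_map M b e = induced_map M b 0"
      using dvd BM ef form_zero_left by (auto simp: induced_map_def fun_eq_iff)
    then have "e = 0"
      using lat BM ef subspace_0[OF subspace_M] unfolding is_lattice_def by (meson inj_onD subsetD)
    then show False
      using B ef dependent_zero by blast
  qed
  have "splitting \<sigma> {} B"
    unfolding splitting_def modular_def using B span_zero by auto
  \<comment> \<open>This first step is made separately to obtain \<open>card T < card B\<close>; maximality gives the rest.\<close>
  from splitting_step[OF \<open>\<sigma> \<noteq> 0\<close> dvd this ef] obtain S\<^sub>1 T\<^sub>1 where
    "splitting \<sigma> S\<^sub>1 T\<^sub>1" and card1: "card T\<^sub>1 < card B"
    by (auto simp: \<sigma>_def)
  from maximal_splitting[OF \<open>\<sigma> \<noteq> 0\<close> dvd this(1)] obtain S T where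
    split: "splitting \<sigma> S T" and card: "card T \<le> card T\<^sub>1"
    and strict: "\<And>x y. x \<in> T \<Longrightarrow> y \<in> T \<Longrightarrow> \<not> b x y dvd \<sigma>"
    by blast
  have fin: "finite S" "finite T" and ind: "independent (S \<union> T)" and sp: "span (S \<union> T) = M"
    and mod: "modular \<sigma> S" and orth: "\<And>s t. s \<in> S \<Longrightarrow> t \<in> T \<Longrightarrow> b s t = 0"
    using split unfolding splitting_def by blast+
  have M: "S \<subseteq> M" "T \<subseteq> M"
    using sp span_superset by blast+
  note sub = subsetD[OF span_subset_M[OF M(1)]] subsetD[OF span_subset_M[OF M(2)]]
  have indS: "independent S" and indT: "independent T"
    using ind independent_mono by blast+
  have latS: "is_lattice (span S) b"
    using orthogonal_summand_is_lattice[OF lat M fin(1) indS sp orth] .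
  have orthTS: "b t s = 0" if "t \<in> T" "s \<in> S" for s t
    using orth[of s t] that M form_commute[of s t] by (auto simp: subset_iff)
  have "span (T \<union> S) = M"
    using sp by (simp add: Un_commute)
  then have latT: "is_lattice (span T) b"
    using orthogonal_summand_is_lattice[OF lat M(2,1) fin(2) indT] orthTS by blast
  have uni: "uni_valued_with (span S) b \<sigma>"
    using modular_lattice_is_uni_valued[OF latS M(1) \<open>\<sigma> \<noteq> 0\<close>] mod dvd sub by blast
  have orth_span: "b x y = 0 \<and> b y x = 0" if "x \<in> span S" "y \<in> span T" for x y
    using orthogonal_spans[OF M orth that] form_commute sub that by metis
  have int: "span S \<inter> span T \<subseteq> {0}"
  proof
    fix x assume x: "x \<in> span S \<inter> span T"
    then have "induced_map (span S) b x = induced_map (span S) b 0"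
      using orth_span form_zero_left sub by (auto simp: induced_map_def fun_eq_iff)
    then show "x \<in> {0}"
      using latS x span_zero unfolding is_lattice_def by (auto dest: inj_onD)
  qed
  have strict_span: "\<not> b x y dvd \<sigma>" if "x \<in> span T" "y \<in> span T" for x y
    by (rule form_on_spans[of T T "\<lambda>r. \<not> r dvd \<sigma>"])
      (use M strict that \<open>\<sigma> \<noteq> 0\<close> in \<open>auto dest: add_dvd_cases dvd_mult_right\<close>)
  show ?thesis
  proof (rule that[OF fin indS indT _ sp latT uni orth_span int _ strict_span])
    show "card T < card B"
      using card card1 by simp
    show "\<exists>x\<in>M. \<exists>y\<in>M. \<sigma> = b x y"
      using ef BM by (auto simp: \<sigma>_def)
  qed
qed

text \<open>
  A Jordan decomposition in terms of divisibility: having different valuations becomes not being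
  associated. That each \<open>\<sigma> k\<close> is a value of the form is carried along for the induction, where it
  separates the scales of the later summands from the new one.
\<close>

definition decomposes :: "'b set \<Rightarrow> ('b \<Rightarrow> 'b \<Rightarrow> 'a) \<Rightarrow> nat \<Rightarrow> (nat \<Rightarrow> 'b set) \<Rightarrow> (nat \<Rightarrow> 'a) \<Rightarrow> bool"
  where "decomposes M b t N \<sigma> \<longleftrightarrow>
    orthogonal_direct_sum M b t N \<and>
    (\<forall>k\<in>{1..t}. uni_valued_with (N k) b (\<sigma> k)) \<and>
    (\<forall>k\<in>{1..t}. \<exists>x\<in>M. \<exists>y\<in>M. \<sigma> k = b x y) \<and>
    (\<forall>k\<in>{1..t}. \<forall>l\<in>{1..t}. k \<noteq> l \<longrightarrow> \<not> (\<sigma> k dvd \<sigma> l \<and> \<sigma> l dvd \<sigma> k))"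

lemma lattice_decomposition:
  assumes "is_lattice M b" "finite B" "independent B" "span B = M"
  shows "\<exists>t N \<sigma>. decomposes M b t N \<sigma>"
  using assms
proof (induction "card B" arbitrary: M B rule: less_induct)
  case less
  show ?case
  proof (cases "B = {}")
    case True
    then have "decomposes M b 0 (\<lambda>_. {}) (\<lambda>_. 0)"
      using less.prems by (auto simp: decomposes_def orthogonal_direct_sum_def bij_betw_def)
    then show ?thesis
      by blast
  next
    case False
    show ?thesis
    proof (rule lattice_splits[OF less.prems False])
      fix \<sigma>\<^sub>0 S T
      assume ST: "finite S" "finite T" "independent S" "independent T"
        and card: "card T < card B" and sp: "span (S \<union> T) = M" and lat: "is_lattice (span T) b"
        and uni: "uni_valued_with (span S) b \<sigma>\<^sub>0"
        and orth: "\<And>x y. x \<in> span S \<Longrightarrow> y \<in> span T \<Longrightarrow> b x y = 0 \<and> b y x = 0"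
        and int: "span S \<inter> span T \<subseteq> {0}"
        and val: "\<exists>x\<in>M. \<exists>y\<in>M. \<sigma>\<^sub>0 = b x y"
        and strict: "\<And>x y. x \<in> span T \<Longrightarrow> y \<in> span T \<Longrightarrow> \<not> b x y dvd \<sigma>\<^sub>0"
      obtain t N \<sigma> where IH: "decomposes (span T) b t N \<sigma>"
        using less.hyps[OF card lat ST(2,4) refl] by blast
      have ods: "orthogonal_direct_sum (span T) b t N"
        and IH_uni: "\<And>k. k \<in> {1..t} \<Longrightarrow> uni_valued_with (N k) b (\<sigma> k)"
        and IH_val: "\<And>k. k \<in> {1..t} \<Longrightarrow> \<exists>x\<in>span T. \<exists>y\<in>span T. \<sigma> k = b x y"
        and IH_distinct: "\<And>k l. k \<in> {1..t} \<Longrightarrow> l \<in> {1..t} \<Longrightarrow> k \<noteq> l \<Longrightarrow>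
          \<not> (\<sigma> k dvd \<sigma> l \<and> \<sigma> l dvd \<sigma> k)"
        using IH unfolding decomposes_def by simp_all
      let ?N = "N(Suc t := span S)" and ?\<sigma> = "\<sigma>(Suc t := \<sigma>\<^sub>0)"
      have TM: "span T \<subseteq> M"
        using sp span_mono[of T "S \<union> T"] by blast
      have "orthogonal_direct_sum M b (Suc t) ?N"
        using orthogonal_direct_sum_snoc[OF ods subspace_span subspace_span _ int orth]
          sp by (simp add: span_Un)
      moreover have "uni_valued_with (?N k) b (?\<sigma> k) \<and> (\<exists>x\<in>M. \<exists>y\<in>M. ?\<sigma> k = b x y)"
        if "k \<in> {1..Suc t}" for k
      proof (cases "k = Suc t")
        case True
        then show ?thesis
          using uni val by simp
      next
        case False
        then have "k \<in> {1..t}"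
          using that by auto
        from IH_uni[OF this] IH_val[OF this] show ?thesis
          using TM False by auto
      qed
      moreover have "\<not> (?\<sigma> k dvd ?\<sigma> l \<and> ?\<sigma> l dvd ?\<sigma> k)"
        if kl: "k \<in> {1..Suc t}" "l \<in> {1..Suc t}" "k \<noteq> l" for k l
      proof -
        have new: "\<not> \<sigma> j dvd \<sigma>\<^sub>0" if "j \<in> {1..t}" for j
          using IH_val[OF that] strict by auto
        consider "k = Suc t" "l \<in> {1..t}" | "l = Suc t" "k \<in> {1..t}" | "k \<in> {1..t}" "l \<in> {1..t}"
          using kl by force
        then show ?thesis
        proof cases
          case 1
          then show ?thesis
            using new[of l] by auto
        next
          case 2
          then show ?thesis
            using new[of k] by auto
        next
          case 3
          then show ?thesis
            using IH_distinct[of k l] kl(3) by auto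
        qed
      qed
      ultimately have "decomposes M b (Suc t) ?N ?\<sigma>"
        unfolding decomposes_def by simp
      then show ?thesis
        by blast
    qed
  qed
qed

end

theorem proposition1p2:
  fixes v :: "'a::idom fract \<Rightarrow> 'g::linordered_ab_group_add"
    and scale :: "'a \<Rightarrow> 'b::ab_group_add \<Rightarrow> 'b"
    and M :: "'b set"
    and b :: "'b \<Rightarrow> 'b \<Rightarrow> 'a"
  assumes "valuation_ring v"
    and "idom_module scale"
    and "idom_module.is_lattice scale M b"
  shows "\<exists>t N \<sigma>. jordan_decomposition v scale M b t N \<sigma>"
proof -
  interpret valuation_ring v
    by fact
  interpret idom_module scale
    by fact
  interpret chain_module scale
    by unfold_locales (rule dvd_total)
  obtain B where "finite B" "independent B" "span B = M"
    using assms(3) unfolding is_lattice_def free_of_finite_rank_def by blast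
  from lattice_decomposition[OF assms(3) this] obtain t N \<sigma> where
    decomp: "decomposes M b t N \<sigma>"
    by blast
  have ods: "orthogonal_direct_sum M b t N"
    and uni: "\<forall>k\<in>{1..t}. uni_valued_with (N k) b (\<sigma> k)"
    and distinct: "\<forall>k\<in>{1..t}. \<forall>l\<in>{1..t}. k \<noteq> l \<longrightarrow> \<not> (\<sigma> k dvd \<sigma> l \<and> \<sigma> l dvd \<sigma> k)"
    using decomp unfolding decomposes_def by simp_all
  have "v (to_fract (\<sigma> k)) \<noteq> v (to_fract (\<sigma> l))"
    if kl: "k \<in> {1..t}" "l \<in> {1..t}" "k \<noteq> l" for k l
  proof
    assume "v (to_fract (\<sigma> k)) = v (to_fract (\<sigma> l))"
    moreover have "\<sigma> k \<noteq> 0" "\<sigma> l \<noteq> 0"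
      using uni kl unfolding uni_valued_with_def by blast+
    ultimately have "\<sigma> k dvd \<sigma> l" "\<sigma> l dvd \<sigma> k"
      by (simp_all add: v_le_imp_dvd)
    with distinct kl show False
      by blast
  qed
  with ods uni have "jordan_decomposition v scale M b t N \<sigma>"
    unfolding jordan_decomposition_def by blast
  then show ?thesis
    by blast
qed

end
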